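(* Let $\Omega\subset\mathbb{R}^n$ be a smooth open domain, let $\Sigma,\Gamma$ be given continuous differential $1$-forms on $\Omega$, and let $(\rho,\hat\rho)$ be a dual pair of densities, $\rho:I\to(0,\infty)$, $\hat\rho:\hat I\to(0,\infty)$. Let $\omega$ be a $k$-form on $\Omega$ with $|\omega|^2\in I$. Then $\omega$ satisfies $$d*\big(\rho(|\omega|^2)\,\omega\big)=\Sigma\wedge *\big(\rho(|\omega|^2)\,\omega\big),\qquad d\omega=\Gamma\wedge\omega$$ if and only if the $(n-k)$-form $\xi:=*\big(\rho(|\omega|^2)\,\omega\big)$ satisfies the dual system $$d*\big(\hat\rho(|\xi|^2)\,\xi\big)=\Gamma\wedge *\big(\hat\rho(|\xi|^2)\,\xi\big),\qquad d\xi=\Sigma\wedge\xi .$$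
   Context: $*$ is the Hodge star of the Euclidean metric on forms on $\Omega$, and $|\omega|^2=*(\omega\wedge*\omega)$. A pair of continuously differentiable densities $(\rho,\hat\rho)$ is a dual pair if $\rho:I\subset[0,\infty)\to(0,\infty)$, $\hat\rho:\hat I:=\phi_\rho(I)\to(0,\infty)$, where $\phi_\rho:t\in I\mapsto\hat t:=t\rho^2(t)$, and $\rho(t)\,\hat\rho(\hat t)=1$ for all $t\in I$, with $\hat t=\phi_\rho(t)$. Solutions are understood classically: $\omega$ and $\rho(|\omega|^2)\omega$ are of class $C^1$. *)

theory Defs
  imports "HOL-Analysis.Analysis"
begin

section \<open>Exterior algebra of Euclidean space\<close>

text \<open>
  The coordinates of R^n are indexed by a finite linearly ordered type \<open>'n\<close>, so that
  \<open>n = CARD('n)\<close>. An element of the full exterior algebra is given by its coefficients with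
  respect to the basis \<open>dx_I = dx_{i1} \<and> ... \<and> dx_{ik}\<close> for \<open>I = {i1 < ... < ik}\<close>. A differential
  form on a set is a function into this algebra, of which only the values on that set matter.
\<close>

type_synonym 'n ext = "real ^ ('n set)"

definition dx :: "'n::{finite,linorder} \<Rightarrow> 'n ext" where
  "dx i = axis {i} 1"

text \<open>For disjoint \<open>I\<close>, \<open>J\<close> this is the sign with \<open>dx_I \<and> dx_J = shuffle_sign I J * dx_{I \<union> J}\<close>.\<close>

definition shuffle_sign :: "'n::{finite,linorder} set \<Rightarrow> 'n set \<Rightarrow> real" where
  "shuffle_sign I J = (-1) ^ card {(i, j). i \<in> I \<and> j \<in> J \<and> j < i}"

definition wedge :: "'n::{finite,linorder} ext \<Rightarrow> 'n ext \<Rightarrow> 'n ext" where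
  "wedge a b = (\<chi> K. \<Sum>I\<in>Pow K. shuffle_sign I (K - I) * (a $ I) * (b $ (K - I)))"

text \<open>
  The Hodge star of the Euclidean metric, for the orientation \<open>dx_UNIV\<close>: on basis elements it is
  \<open>*dx_I = shuffle_sign I (-I) * dx_{-I}\<close>, equivalently \<open>a \<and> *b = \<langle>a, b\<rangle> dx_UNIV\<close> for \<open>a\<close>, \<open>b\<close> of the
  same degree (lemma \<open>wedge_hodge\<close> below).
\<close>

definition hodge :: "'n::{finite,linorder} ext \<Rightarrow> 'n ext" where
  "hodge a = (\<chi> J. shuffle_sign (- J) J * (a $ (- J)))"

text \<open>\<open>|a|^2 = *(a \<and> *a)\<close>, where a 0-form is identified with its only coefficient.\<close>

definition normsq :: "'n::{finite,linorder} ext \<Rightarrow> real" where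
  "normsq a = hodge (wedge a (hodge a)) $ {}"

definition homogeneous :: "nat \<Rightarrow> 'n::{finite,linorder} ext \<Rightarrow> bool" where
  "homogeneous k a \<longleftrightarrow> (\<forall>I. card I \<noteq> k \<longrightarrow> a $ I = 0)"

lemma shuffle_sign_square [simp]: "shuffle_sign I J * shuffle_sign I J = 1"
  by (simp add: shuffle_sign_def flip: power_add)

lemma wedge_hodge:
  assumes "homogeneous k a" and "homogeneous k b"
  shows "wedge a (hodge b) = inner a b *\<^sub>R axis UNIV 1"
proof -
  have "(\<Sum>I\<in>Pow K. shuffle_sign I (K - I) * (a $ I) * (hodge b $ (K - I)))
      = (if K = UNIV then inner a b else 0)" for K
  proof (cases "K = UNIV")
    case True
    have [simp]: "shuffle_sign I (- I) * (a $ I) * (shuffle_sign I (- I) * (b $ I)) = a $ I * b $ I" for I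
      by (metis shuffle_sign_square mult.assoc mult.left_commute mult_1)
    then show ?thesis
      unfolding True
      by (simp add: hodge_def inner_vec_def Compl_eq_Diff_UNIV [symmetric])
  next
    case False
    have "a $ I = 0 \<or> b $ (- (K - I)) = 0" if "I \<subseteq> K" for I
    proof -
      have "I \<subset> - (K - I)" using that False by auto
      then have "card I \<noteq> card (- (K - I))"
        by (metis finite_code psubset_card_mono less_irrefl)
      then show ?thesis using assms by (metis homogeneous_def)
    qed
    then have "(\<Sum>I\<in>Pow K. shuffle_sign I (K - I) * (a $ I) * (hodge b $ (K - I))) = 0"
      by (intro sum.neutral) (auto simp: hodge_def simp del: Compl_Diff_eq)
    with False show ?thesis by simp
  qed
  then show ?thesis
    by (simp add: vec_eq_iff wedge_def axis_def)
qed

lemma normsq_eq_inner: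
  assumes "homogeneous k a"
  shows "normsq a = inner a a"
  unfolding normsq_def wedge_hodge[OF assms assms]
  by (simp add: hodge_def shuffle_sign_def axis_def)

lemma wedge_axis:
  "wedge (axis I 1) (axis J 1) =
     (if I \<inter> J = {} then shuffle_sign I J *\<^sub>R axis (I \<union> J) 1 else 0)"
proof -
  have "(\<Sum>I'\<in>Pow K. shuffle_sign I' (K - I') * (axis I 1 $ I') * (axis J 1 $ (K - I')))
      = (if I \<subseteq> K \<and> K - I = J then shuffle_sign I J else 0)" for K
  proof -
    have "(\<Sum>I'\<in>Pow K. shuffle_sign I' (K - I') * (axis I 1 $ I') * (axis J 1 $ (K - I')))
        = (\<Sum>I'\<in>Pow K. if I' = I then (if K - I = J then shuffle_sign I J else 0) else 0)"
      by (rule sum.cong) (auto simp: axis_def)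
    then show ?thesis by (simp add: sum.delta)
  qed
  moreover have "I \<subseteq> K \<and> K - I = J \<longleftrightarrow> I \<inter> J = {} \<and> K = I \<union> J" for K
    by blast
  ultimately show ?thesis
    by (auto simp: vec_eq_iff wedge_def axis_def)
qed

lemma wedge_dx_anticommute: "wedge (dx i) (dx j) = - wedge (dx j) (dx i)"
proof -
  have "{(a, b). a = i \<and> b = j \<and> b < a} = (if j < i then {(i, j)} else {})" for i j :: 'a
    by auto
  then show ?thesis
    by (cases i j rule: linorder_cases)
       (auto simp: dx_def wedge_axis shuffle_sign_def insert_commute)
qed

section \<open>Differential forms\<close>

type_synonym 'n form = "real ^ 'n \<Rightarrow> 'n ext"

definition form_on :: "nat \<Rightarrow> (real ^ 'n::{finite,linorder}) set \<Rightarrow> 'n form \<Rightarrow> bool" where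
  "form_on k \<Omega> \<omega> \<longleftrightarrow> (\<forall>x\<in>\<Omega>. homogeneous k (\<omega> x))"

definition partial_deriv ::
  "'n::finite \<Rightarrow> (real ^ 'n \<Rightarrow> 'b::real_normed_vector) \<Rightarrow> real ^ 'n \<Rightarrow> 'b" where
  "partial_deriv i f x = frechet_derivative f (at x) (axis i 1)"

definition ext_deriv ::
  "'n::{finite,linorder} form \<Rightarrow> 'n form" where
  "ext_deriv \<omega> x = (\<Sum>i\<in>UNIV. wedge (dx i) (partial_deriv i \<omega> x))"

text \<open>Derivatives are taken within \<open>S\<close>, so that \<open>S\<close> may be an interval containing end points.\<close>

definition C1_on ::
  "'a::real_normed_vector set \<Rightarrow> ('a \<Rightarrow> 'b::real_normed_vector) \<Rightarrow> bool" where
  "C1_on S f \<longleftrightarrow> (\<exists>f' :: 'a \<Rightarrow> 'a \<Rightarrow>\<^sub>L 'b.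
     (\<forall>x\<in>S. (f has_derivative blinfun_apply (f' x)) (at x within S)) \<and> continuous_on S f')"

section \<open>Smooth domains\<close>

text \<open>\<open>Ck_on m U f\<close> is meant for open \<open>U\<close>.\<close>

primrec Ck_on :: "nat \<Rightarrow> (real ^ 'n::finite) set \<Rightarrow> (real ^ 'n::finite \<Rightarrow> real) \<Rightarrow> bool" where
  "Ck_on 0 U f \<longleftrightarrow> continuous_on U f"
| "Ck_on (Suc m) U f \<longleftrightarrow> f differentiable_on U \<and> (\<forall>i. Ck_on m U (partial_deriv i f))"

text \<open>
  A domain with smooth boundary: near each boundary point it is a strict sublevel set of a smooth
  function with nonvanishing gradient. The boundary may be empty.
\<close>

definition smooth_domain :: "(real ^ 'n::finite) set \<Rightarrow> bool" where
  "smooth_domain \<Omega> \<longleftrightarrow> open \<Omega> \<and> connected \<Omega> \<and> \<Omega> \<noteq> {} \<and>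
     (\<forall>p\<in>frontier \<Omega>. \<exists>U g. open U \<and> p \<in> U \<and> (\<forall>m. Ck_on m U g) \<and>
        (\<exists>i. partial_deriv i g p \<noteq> 0) \<and> \<Omega> \<inter> U = {x \<in> U. g x < 0})"

section \<open>Dual pairs of densities and the nonlinear system\<close>

definition density_map :: "(real \<Rightarrow> real) \<Rightarrow> real \<Rightarrow> real" where
  "density_map \<rho> t = t * (\<rho> t)\<^sup>2"

definition dual_pair :: "real set \<Rightarrow> (real \<Rightarrow> real) \<Rightarrow> (real \<Rightarrow> real) \<Rightarrow> bool" where
  "dual_pair I \<rho> \<rho>hat \<longleftrightarrow>
     I \<subseteq> {0..} \<and> (\<forall>t\<in>I. \<rho> t > 0) \<and> C1_on I \<rho> \<and>
     (\<forall>s\<in>density_map \<rho> ` I. \<rho>hat s > 0) \<and> C1_on (density_map \<rho> ` I) \<rho>hat \<and>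
     (\<forall>t\<in>I. \<rho> t * \<rho>hat (density_map \<rho> t) = 1)"

definition weighted ::
  "(real \<Rightarrow> real) \<Rightarrow> 'n::{finite,linorder} form \<Rightarrow> 'n form" where
  "weighted \<rho> \<omega> x = \<rho> (normsq (\<omega> x)) *\<^sub>R \<omega> x"

definition classical_solution ::
  "(real ^ 'n::{finite,linorder}) set \<Rightarrow> (real \<Rightarrow> real) \<Rightarrow> 'n form \<Rightarrow> 'n form \<Rightarrow> 'n form \<Rightarrow> bool" where
  "classical_solution \<Omega> \<rho> \<Sigma> \<Gamma> \<omega> \<longleftrightarrow>
     C1_on \<Omega> \<omega> \<and> C1_on \<Omega> (weighted \<rho> \<omega>) \<and>
     (\<forall>x\<in>\<Omega>. ext_deriv (\<lambda>y. hodge (weighted \<rho> \<omega> y)) x = wedge (\<Sigma> x) (hodge (weighted \<rho> \<omega> x))) \<and>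
     (\<forall>x\<in>\<Omega>. ext_deriv \<omega> x = wedge (\<Gamma> x) (\<omega> x))"

end

theory Submission
  imports Defs
begin

text \<open>
  On \<open>\<Omega>\<close> one has \<open>|\<xi>|\<^sup>2 = \<rho>\<^sup>2 |\<omega>|\<^sup>2\<close>, the image of \<open>|\<omega>|\<^sup>2\<close> under the density map, so the
  duality \<open>\<rho> \<rho>hat = 1\<close> gives \<open>\<rho>hat(|\<xi>|\<^sup>2) \<xi> = *\<omega>\<close>. Applying the star once more yields
  \<open>\<plusminus>\<omega>\<close> with a sign depending only on the degree, and the two equations of the system change places.
\<close>

lemma wedge_scaleR_right: "wedge a (c *\<^sub>R b) = c *\<^sub>R wedge a b"
  by (simp add: wedge_def vec_eq_iff sum_distrib_left algebra_simps)

lemma linear_hodge: "linear hodge"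
  by (rule linearI) (simp_all add: hodge_def vec_eq_iff algebra_simps)

lemma bounded_linear_hodge: "bounded_linear hodge"
  using linear_hodge linear_conv_bounded_linear by blast

lemma hodge_scaleR: "hodge (c *\<^sub>R a) = c *\<^sub>R hodge a"
  using linear_hodge by (rule linear_scale)

lemma homogeneous_scaleR: "homogeneous k a \<Longrightarrow> homogeneous k (c *\<^sub>R a)"
  by (simp add: homogeneous_def)

lemma card_Compl_finite: "card (- A) = CARD('a) - card (A :: 'a::finite set)"
  by (simp add: Compl_eq_Diff_UNIV card_Diff_subset)

lemma homogeneous_hodge:
  fixes a :: "'n::{finite,linorder} ext"
  assumes "homogeneous k a" and "k \<le> CARD('n)"
  shows "homogeneous (CARD('n) - k) (hodge a)"
proof -
  have "card (- J) \<noteq> k" if "card J \<noteq> CARD('n) - k" for J :: "'n set"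
    using that assms(2) card_mono[OF finite subset_UNIV, of J] by (simp add: card_Compl_finite)
  with assms(1) show ?thesis
    by (simp add: homogeneous_def hodge_def)
qed

text \<open>The star permutes the coefficients by complementation of index sets, up to signs. Each
  product of coefficients carries the same sign twice, so the signs cancel.\<close>

lemma inner_hodge_hodge: "inner (hodge a) (hodge b) = inner a b"
proof -
  have *: "(s * x) * (s * y) = x * y" if "s * s = 1" for s x y :: real
    using that by (metis mult.assoc mult.left_commute mult_1)
  have "inner (hodge a) (hodge b) = (\<Sum>J\<in>UNIV. a $ (- J) * b $ (- J))"
    by (simp add: inner_vec_def hodge_def *)
  also have "\<dots> = inner a b"
    unfolding inner_vec_def inner_real_def
    by (rule sum.reindex_bij_betw[OF bij_betwI[where g = uminus]]) auto
  finally show ?thesis .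
qed

text \<open>As \<open>I\<close> and \<open>J\<close> are disjoint, every pair in
  \<open>I \<times> J\<close> is an inversion for exactly one of the two orders. The two exponents
  therefore add up to the number of all pairs.\<close>

lemma shuffle_sign_swap:
  assumes "I \<inter> J = {}"
  shows "shuffle_sign I J * shuffle_sign J I = (-1) ^ (card I * card J)"
proof -
  define A where "A = {(i, j). i \<in> I \<and> j \<in> J \<and> j < i}"
  define B where "B = {(j, i). j \<in> J \<and> i \<in> I \<and> i < j}"
  have "A \<union> prod.swap ` B = I \<times> J" "A \<inter> prod.swap ` B = {}"
    using assms by (auto simp: A_def B_def image_iff)
  then have "card A + card (prod.swap ` B) = card (I \<times> J)"
    by (metis card_Un_disjoint finite_code)
  moreover have "card (prod.swap ` B) = card B"
    by (simp add: card_image)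
  ultimately show ?thesis
    by (simp add: shuffle_sign_def A_def B_def card_cartesian_product flip: power_add)
qed

text \<open>The coefficient at \<open>J\<close> collects the shuffle signs of \<open>J\<close> and
  its complement in both orders. Their product depends only on \<open>card J\<close>, and only the
  coefficients with \<open>card J = k\<close> survive, so one constant serves for the whole
  form.\<close>

lemma hodge_hodge:
  fixes a :: "'n::{finite,linorder} ext"
  assumes "homogeneous k a"
  shows "hodge (hodge a) = (-1) ^ (k * (CARD('n) - k)) *\<^sub>R a"
proof -
  have "shuffle_sign (- J) J * (shuffle_sign J (- J) * a $ J)
      = (-1) ^ (k * (CARD('n) - k)) * a $ J" for J
  proof (cases "card J = k")
    case True
    have "shuffle_sign (- J) J * shuffle_sign J (- J) = (-1) ^ (card (- J) * card J)"
      by (rule shuffle_sign_swap) simp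
    also have "card (- J) * card J = k * (CARD('n) - k)"
      by (simp add: card_Compl_finite True)
    finally show ?thesis by (simp flip: mult.assoc)
  next
    case False
    with assms show ?thesis by (simp add: homogeneous_def)
  qed
  then show ?thesis
    by (simp add: vec_eq_iff hodge_def)
qed

text \<open>A derivative within \<open>S\<close> at a point of \<open>S\<close> depends only on the
  values on \<open>S\<close>. This matters because forms are arbitrary off the domain and the
  identities between them hold only on it.\<close>

lemma C1_on_cong:
  assumes "\<And>x. x \<in> S \<Longrightarrow> f x = g x"
  shows "C1_on S f \<longleftrightarrow> C1_on S g"
proof -
  have "(f has_derivative D) (at x within S) \<longleftrightarrow> (g has_derivative D) (at x within S)"
    if "x \<in> S" for D x
    using has_derivative_transform[OF that, of f g] has_derivative_transform[OF that, of g f] assms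
    by auto
  then show ?thesis
    by (simp add: C1_on_def)
qed

lemma C1_on_bounded_linear:
  assumes "bounded_linear h" and "C1_on S f"
  shows "C1_on S (\<lambda>x. h (f x))"
proof -
  from assms(2) obtain f' where f':
    "\<And>x. x \<in> S \<Longrightarrow> (f has_derivative blinfun_apply (f' x)) (at x within S)" "continuous_on S f'"
    by (auto simp: C1_on_def)
  have "((\<lambda>x. h (f x)) has_derivative blinfun_apply (Blinfun h o\<^sub>L f' x)) (at x within S)"
    if "x \<in> S" for x
    using bounded_linear.has_derivative[OF assms(1) f'(1)[OF that]]
    by (simp add: o_def bounded_linear_Blinfun_apply[OF assms(1)] blinfun_compose.rep_eq)
  moreover have "continuous_on S (\<lambda>x. Blinfun h o\<^sub>L f' x)"
    by (intro continuous_intros f'(2))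
  ultimately show ?thesis
    unfolding C1_on_def by (intro exI[of _ "\<lambda>x. Blinfun h o\<^sub>L f' x"]) auto
qed

lemma C1_on_hodge_iff:
  assumes "form_on k S \<alpha>"
  shows "C1_on S (\<lambda>x. hodge (\<alpha> x)) \<longleftrightarrow> C1_on S \<alpha>"
proof
  \<comment> \<open>The sign \<open>c\<close> is its own inverse, so a second star followed by
    multiplication by \<open>c\<close> recovers the form from its star.\<close>
  define c :: real where "c = (-1) ^ (k * (CARD('a) - k))"
  have c: "c * c = 1" by (simp add: c_def flip: power_mult_distrib)
  assume "C1_on S (\<lambda>x. hodge (\<alpha> x))"
  then have "C1_on S (\<lambda>x. c *\<^sub>R hodge (hodge (\<alpha> x)))"
    by (rule C1_on_bounded_linear
        [OF bounded_linear_compose[OF bounded_linear_scaleR_right bounded_linear_hodge]])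
  moreover have eq: "c *\<^sub>R hodge (hodge (\<alpha> x)) = \<alpha> x" if "x \<in> S" for x
    using hodge_hodge assms that c by (fastforce simp: form_on_def c_def)
  ultimately show "C1_on S \<alpha>"
    using C1_on_cong[of S, OF eq] by simp
qed (rule C1_on_bounded_linear[OF bounded_linear_hodge])

lemma partial_deriv_cong_open:
  assumes "open S" and "x \<in> S" and "\<And>y. y \<in> S \<Longrightarrow> f y = g y"
  shows "partial_deriv i f x = partial_deriv i g x"
proof -
  \<comment> \<open>\<open>frechet_derivative\<close> is a choice among all derivatives, so having
    the same set of derivatives makes the choices agree, even where that set is empty.\<close>
  have "(f has_derivative D) (at x) \<longleftrightarrow> (g has_derivative D) (at x)" for D
    using has_derivative_transform_within_open[OF _ assms(1,2)] assms(3) by metis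
  then show ?thesis
    by (simp add: partial_deriv_def frechet_derivative_def)
qed

lemma ext_deriv_cong_open:
  assumes "open S" and "x \<in> S" and "\<And>y. y \<in> S \<Longrightarrow> \<alpha> y = \<beta> y"
  shows "ext_deriv \<alpha> x = ext_deriv \<beta> x"
  using partial_deriv_cong_open[OF assms] by (simp add: ext_deriv_def)

text \<open>Differentiability ensures that \<open>frechet_derivative\<close> is a true derivative
  rather than an arbitrary default, so that the factor can be pulled out.\<close>

lemma ext_deriv_scaleR:
  assumes "\<alpha> differentiable (at x)"
  shows "ext_deriv (\<lambda>y. c *\<^sub>R \<alpha> y) x = c *\<^sub>R ext_deriv \<alpha> x"
proof -
  have "((\<lambda>y. c *\<^sub>R \<alpha> y) has_derivative (\<lambda>v. c *\<^sub>R frechet_derivative \<alpha> (at x) v)) (at x)"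
    using assms by (intro has_derivative_scaleR_right) (simp add: frechet_derivative_works)
  then have "partial_deriv i (\<lambda>y. c *\<^sub>R \<alpha> y) x = c *\<^sub>R partial_deriv i \<alpha> x" for i
    unfolding partial_deriv_def by (metis frechet_derivative_at)
  then show ?thesis
    by (simp add: ext_deriv_def wedge_scaleR_right scaleR_sum_right)
qed

lemma C1_on_open_differentiable:
  assumes "C1_on S f" and "open S" and "x \<in> S"
  shows "f differentiable (at x)"
  using assms by (metis C1_on_def at_within_open differentiable_def)

theorem proposition4p2:
  fixes \<Omega> :: "(real ^ 'n::{finite,linorder}) set"
    and \<Sigma> \<Gamma> \<omega> \<xi> :: "'n form"
    and \<rho> \<rho>hat :: "real \<Rightarrow> real"
    and I :: "real set"
    and k :: nat
  assumes "smooth_domain \<Omega>"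
    and "form_on 1 \<Omega> \<Sigma>" and "continuous_on \<Omega> \<Sigma>"
    and "form_on 1 \<Omega> \<Gamma>" and "continuous_on \<Omega> \<Gamma>"
    and "dual_pair I \<rho> \<rho>hat"
    and "k \<le> CARD('n)"
    and "form_on k \<Omega> \<omega>"
    and "\<forall>x\<in>\<Omega>. normsq (\<omega> x) \<in> I"
    and "\<xi> = (\<lambda>x. hodge (weighted \<rho> \<omega> x))"
  shows "form_on (CARD('n) - k) \<Omega> \<xi> \<and>
    (\<forall>x\<in>\<Omega>. normsq (\<xi> x) \<in> density_map \<rho> ` I) \<and>
    (classical_solution \<Omega> \<rho> \<Sigma> \<Gamma> \<omega> \<longleftrightarrow> classical_solution \<Omega> \<rho>hat \<Gamma> \<Sigma> \<xi>)"
proof (intro conjI)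
  have op: "open \<Omega>" using assms(1) by (simp add: smooth_domain_def)
  have hom: "homogeneous k (\<omega> x)" if "x \<in> \<Omega>" for x
    using assms(8) that by (simp add: form_on_def)
  have homw: "form_on k \<Omega> (weighted \<rho> \<omega>)"
    using hom by (simp add: form_on_def weighted_def homogeneous_scaleR)
  show form_xi: "form_on (CARD('n) - k) \<Omega> \<xi>"
    using homw assms(7) by (simp add: form_on_def homogeneous_hodge assms(10))
  have nxi: "normsq (\<xi> x) = density_map \<rho> (normsq (\<omega> x))" if "x \<in> \<Omega>" for x
  proof -
    have "normsq (\<xi> x) = inner (\<xi> x) (\<xi> x)"
      using form_xi that by (auto simp: form_on_def intro: normsq_eq_inner)
    also have "\<dots> = (\<rho> (normsq (\<omega> x)))\<^sup>2 * inner (\<omega> x) (\<omega> x)"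
      by (simp add: assms(10) inner_hodge_hodge weighted_def power2_eq_square mult.assoc)
    finally show ?thesis
      by (simp add: density_map_def normsq_eq_inner[OF hom[OF that]])
  qed
  show "\<forall>x\<in>\<Omega>. normsq (\<xi> x) \<in> density_map \<rho> ` I"
    using nxi assms(9) by simp
  \<comment> \<open>By \<open>nxi\<close> the density \<open>\<rho>hat\<close> is evaluated exactly
    at the dual point of \<open>normsq (\<omega> x)\<close>, so the two weights cancel.\<close>
  have wxi: "weighted \<rho>hat \<xi> x = hodge (\<omega> x)" if "x \<in> \<Omega>" for x
  proof -
    have "\<rho> (normsq (\<omega> x)) * \<rho>hat (normsq (\<xi> x)) = 1"
      using assms(6,9) that by (simp add: dual_pair_def nxi)
    then show ?thesis
      by (simp add: weighted_def[of \<rho>hat] assms(10) weighted_def[of \<rho>] hodge_scaleR mult.commute)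
  qed
  define c :: real where "c = (-1) ^ (k * (CARD('n) - k))"
  have "c \<noteq> 0" by (simp add: c_def)
  have hwxi: "hodge (weighted \<rho>hat \<xi> x) = c *\<^sub>R \<omega> x" if "x \<in> \<Omega>" for x
    using that by (simp add: wxi hodge_hodge[OF hom] c_def)
  \<comment> \<open>The two regularity conditions change places, since the star preserves
    \<open>C1_on\<close> in both directions.\<close>
  have "C1_on \<Omega> \<xi> \<longleftrightarrow> C1_on \<Omega> (weighted \<rho> \<omega>)"
    unfolding assms(10) by (rule C1_on_hodge_iff[OF homw])
  moreover have "C1_on \<Omega> (weighted \<rho>hat \<xi>) \<longleftrightarrow> C1_on \<Omega> \<omega>"
    using C1_on_cong[of \<Omega>, OF wxi] C1_on_hodge_iff[OF assms(8)] by simp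
  \<comment> \<open>Both sides of the dual equation are \<open>c\<close> times those of the original
    one, and \<open>c\<close> cancels. The regularity of \<open>\<omega>\<close> is available from
    either system by the preceding equivalence.\<close>
  moreover have "ext_deriv (\<lambda>y. hodge (weighted \<rho>hat \<xi> y)) x = wedge (\<Gamma> x) (hodge (weighted \<rho>hat \<xi> x))
      \<longleftrightarrow> ext_deriv \<omega> x = wedge (\<Gamma> x) (\<omega> x)" if "C1_on \<Omega> \<omega>" "x \<in> \<Omega>" for x
  proof -
    have "ext_deriv (\<lambda>y. hodge (weighted \<rho>hat \<xi> y)) x = c *\<^sub>R ext_deriv \<omega> x"
      using ext_deriv_cong_open[OF op that(2) hwxi]
        ext_deriv_scaleR[OF C1_on_open_differentiable[OF that(1) op that(2)]] by simp
    then show ?thesis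
      using \<open>c \<noteq> 0\<close> that(2) by (simp add: hwxi wedge_scaleR_right)
  qed
  \<comment> \<open>The equation with \<open>\<Sigma>\<close> is literally the same in both systems
    once \<open>\<xi>\<close> is unfolded.\<close>
  ultimately show "classical_solution \<Omega> \<rho> \<Sigma> \<Gamma> \<omega> \<longleftrightarrow> classical_solution \<Omega> \<rho>hat \<Gamma> \<Sigma> \<xi>"
    unfolding classical_solution_def by (auto simp: assms(10))
qed

end
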